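(* For any fixed $1\le j\le n$, the functionals $\mathbb V_j$ and $\widetilde{\mathbb V}_j$ are lower semicontinuous on their domain $\mathcal F_{n,d}$.
   Context: Fix natural numbers $n\ge2$ and $d\ge2$ with $d$ even. $\mathcal H_{n,d}$ is the finite-dimensional vector space of positively $d$-homogeneous polynomials $f:\mathbb R^n\to\mathbb R$ ($f(\lambda x)=\lambda^df(x)$ for $\lambda>0$), equipped with the topology of uniform convergence on the unit sphere $\mathbb S^{n-1}$. $\mathcal F_{n,d}:=\{f\in\mathcal H_{n,d}:f(x)>0\ \text{for all }x\neq0\}$. $G(j,n)$ is the Grassmannian of $j$-dimensional linear subspaces of $\mathbb R^n$ with its rotation-invariant (Haar) probability measure $\nu_j$; $\kappa_m$ is the volume of the unit ball of $\mathbb R^m$. For $E\in G(j,n)$, $y\in E$: $\Pi_Ef(y):=\inf_{z\in E^\perp}f(y+z)$ and $\mathscr R_Ef:=f|_E$. Set $\beta_{j,n}=\binom nj\frac{\kappa_n}{\kappa_j\kappa_{n-j}}$ and $\sigma_{j,n}=\frac{\kappa_n}{\kappa_{n-j}}$. For $f\in\mathcal F_{n,d}$ and $1\le j\le n-1$, $$\mathbb V_j(f):=\frac{\beta_{j,n}}{\Gamma(1+j/d)}\int_{G(j,n)}\int_E e^{-\Pi_Ef(y)}\,dy\,d\nu_j(E),\qquad \widetilde{\mathbb V}_j(f):=\frac{\sigma_{j,n}}{\Gamma(1+j/d)}\int_{G(j,n)}\int_E e^{-\mathscr R_Ef(y)}\,dy\,d\nu_j(E),$$ and $\mathbb V_n(f)=\widetilde{\mathbb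 V}_n(f):=\frac1{\Gamma(1+n/d)}\int_{\mathbb R^n}e^{-f(x)}\,dx$; all are set to $+\infty$ on $\mathcal H_{n,d}\setminus\mathcal F_{n,d}$. They are finite exactly on $\mathcal F_{n,d}$, which is called their domain. *)

theory Defs
  imports "HOL-Probability.Probability_Measure"
begin

text \<open>
  Throughout, the ambient space is \<open>real ^ 'n\<close>, so the dimension \<open>n\<close> is \<open>CARD('n)\<close>.
\<close>

section \<open>Homogeneous polynomials and uniform convergence on the unit sphere\<close>

definition hom_poly :: "nat \<Rightarrow> (real ^ 'n \<Rightarrow> real) set" where
  "hom_poly d =
    {f. real_polynomial_function f \<and> (\<forall>c>0. \<forall>x. f (c *\<^sub>R x) = c ^ d * f x)}"

definition pos_hom_poly :: "nat \<Rightarrow> (real ^ 'n \<Rightarrow> real) set" where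
  "pos_hom_poly d = {f \<in> hom_poly d. \<forall>x. x \<noteq> 0 \<longrightarrow> f x > 0}"

text \<open>
  The value outside \<open>hom_poly d\<close> is a dummy: the locale \<open>Metric_space\<close> asks for a distance that
  is nonnegative on the whole type.
\<close>
definition sphere_dist :: "nat \<Rightarrow> (real ^ 'n \<Rightarrow> real) \<Rightarrow> (real ^ 'n \<Rightarrow> real) \<Rightarrow> real" where
  "sphere_dist d f g =
    (if f \<in> hom_poly d \<and> g \<in> hom_poly d then SUP x\<in>sphere 0 1. \<bar>f x - g x\<bar> else 0)"

definition hom_poly_topology :: "nat \<Rightarrow> (real ^ 'n \<Rightarrow> real) topology" where
  "hom_poly_topology d = Metric_space.mtopology (hom_poly d) (sphere_dist d)"

lemma hom_poly_continuous_on: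
  assumes "f \<in> hom_poly d"
  shows "continuous_on S f"
  using assms continuous_real_polymonial_function
  by (auto simp: hom_poly_def intro: continuous_at_imp_continuous_on)

lemma sphere_vec_nonempty: "sphere (0 :: real ^ 'n) 1 \<noteq> {}"
  by simp

lemma bdd_above_sphere_diff:
  assumes "f \<in> hom_poly d" "g \<in> hom_poly d"
  shows "bdd_above ((\<lambda>x. \<bar>f x - g x\<bar>) ` sphere 0 1)"
  by (intro bounded_imp_bdd_above compact_imp_bounded compact_continuous_image
        continuous_intros hom_poly_continuous_on[OF assms(1)] hom_poly_continuous_on[OF assms(2)])
     simp

lemma abs_diff_le_sphere_dist:
  assumes "f \<in> hom_poly d" "g \<in> hom_poly d" "norm x = 1"
  shows "\<bar>f x - g x\<bar> \<le> sphere_dist d f g"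
  using assms unfolding sphere_dist_def
  by (auto intro!: cSUP_upper2[OF _ _ order_refl] bdd_above_sphere_diff)

lemma sphere_dist_le:
  assumes "f \<in> hom_poly d" "g \<in> hom_poly d" "\<And>x. norm x = 1 \<Longrightarrow> \<bar>f x - g x\<bar> \<le> b"
  shows "sphere_dist d f g \<le> b"
  using assms sphere_vec_nonempty unfolding sphere_dist_def
  by (auto intro!: cSUP_least)

lemma hom_poly_eqI:
  assumes f: "f \<in> hom_poly d" and g: "g \<in> hom_poly d"
    and eq: "\<And>x. norm x = 1 \<Longrightarrow> f x = g x"
  shows "f = g"
proof -
  have nz: "f x = g x" if "x \<noteq> 0" for x
  proof -
    define u where "u = x /\<^sub>R norm x"
    have u: "norm x *\<^sub>R u = x" "norm u = 1" and p: "norm x > 0"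
      using that by (auto simp: u_def)
    have "f (norm x *\<^sub>R u) = norm x ^ d * f u" "g (norm x *\<^sub>R u) = norm x ^ d * g u"
      using f g p unfolding hom_poly_def by blast+
    then show ?thesis using eq[OF u(2)] u(1) by simp
  qed
  have "f 0 = g 0"
  proof -
    have c: "isCont f 0" "isCont g 0"
      using f g continuous_real_polymonial_function by (auto simp: hom_poly_def)
    have "(f \<longlongrightarrow> g 0) (at 0)"
      by (rule Lim_transform_eventually[OF c(2)[unfolded isCont_def]])
         (simp add: eventually_at_filter nz)
    with c(1) show ?thesis
      unfolding isCont_def using LIM_unique by blast
  qed
  show ?thesis
  proof
    fix x show "f x = g x"
      using nz \<open>f 0 = g 0\<close> by (cases "x = 0") simp_all
  qed
qed

lemma Metric_space_hom_poly: "Metric_space (hom_poly d) (sphere_dist d)"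
proof
  obtain e :: "real ^ 'n" where e: "norm e = 1"
    using vector_choose_size[of 1] by auto
  fix f g h :: "real ^ 'n \<Rightarrow> real"
  show nn: "0 \<le> sphere_dist d f g" for f g :: "real ^ 'n \<Rightarrow> real"
  proof (cases "f \<in> hom_poly d \<and> g \<in> hom_poly d")
    case True
    then show ?thesis
      using abs_diff_le_sphere_dist[of f d g e] e by linarith
  qed (auto simp: sphere_dist_def)
  show "sphere_dist d f g = sphere_dist d g f"
    by (simp add: sphere_dist_def abs_minus_commute)
  {
    assume fg: "f \<in> hom_poly d" "g \<in> hom_poly d"
    show "sphere_dist d f g = 0 \<longleftrightarrow> f = g"
    proof
      assume "sphere_dist d f g = 0"
      then show "f = g"
        using abs_diff_le_sphere_dist[OF fg] by (intro hom_poly_eqI[OF fg]) simp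
    next
      assume "f = g"
      then have "sphere_dist d f g \<le> 0"
        by (intro sphere_dist_le fg) auto
      then show "sphere_dist d f g = 0"
        using nn[of f g] by linarith
    qed
    assume h: "h \<in> hom_poly d"
    show "sphere_dist d f h \<le> sphere_dist d f g + sphere_dist d g h"
    proof (rule sphere_dist_le[OF fg(1) h])
      fix x :: "real ^ 'n" assume "norm x = 1"
      then show "\<bar>f x - h x\<bar> \<le> sphere_dist d f g + sphere_dist d g h"
        using abs_diff_le_sphere_dist[OF fg, of x] abs_diff_le_sphere_dist[OF fg(2) h, of x]
        by linarith
    qed
  }
qed

lemma topspace_hom_poly_topology [simp]: "topspace (hom_poly_topology d) = hom_poly d"
  unfolding hom_poly_topology_def
  by (rule Metric_space.topspace_mtopology[OF Metric_space_hom_poly])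


section \<open>The Grassmannian and its rotation-invariant probability measure\<close>

definition grassmannian :: "nat \<Rightarrow> (real ^ 'n) set set" where
  "grassmannian j = {E. subspace E \<and> dim E = j}"

text \<open>
  The topology of the Grassmannian is the one induced by the embedding that sends \<open>E\<close> to the matrix
  of the orthogonal projection onto \<open>E\<close>; this is its Borel \<open>\<sigma>\<close>-algebra.
\<close>
definition grassmannian_borel :: "nat \<Rightarrow> (real ^ 'n) set measure" where
  "grassmannian_borel j =
    vimage_algebra (grassmannian j) (\<lambda>E. matrix (closest_point E)) (borel :: (real ^ 'n ^ 'n) measure)"

text \<open>
  For \<open>1 \<le> j < n\<close> the rotation group is transitive on the Grassmannian, so these properties
  determine \<open>\<nu>\<close> uniquely.
\<close>
definition grassmannian_haar :: "nat \<Rightarrow> (real ^ 'n) set measure \<Rightarrow> bool" where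
  "grassmannian_haar j \<nu> \<longleftrightarrow>
    prob_space \<nu> \<and> sets \<nu> = sets (grassmannian_borel j) \<and>
    (\<forall>Q :: real ^ 'n ^ 'n. rotation_matrix Q \<longrightarrow> distr \<nu> \<nu> (\<lambda>E. (*v) Q ` E) = \<nu>)"

definition orthonormal_basis :: "(real ^ 'n) set \<Rightarrow> (real ^ 'n) set" where
  "orthonormal_basis E =
    (SOME B. pairwise orthogonal B \<and> (\<forall>b\<in>B. norm b = 1) \<and> span B = E)"

text \<open>
  Lebesgue measure on a subspace: the definition of \<open>lborel\<close> with an orthonormal basis of \<open>E\<close> in
  place of \<open>Basis\<close>. By rotation invariance the choice of the basis does not matter.
\<close>
definition subspace_lborel :: "(real ^ 'n) set \<Rightarrow> (real ^ 'n) measure" where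
  "subspace_lborel E =
    distr (\<Pi>\<^sub>M b\<in>orthonormal_basis E. lborel) (restrict_space borel E)
      (\<lambda>c. \<Sum>b\<in>orthonormal_basis E. c b *\<^sub>R b)"


section \<open>The functionals\<close>

definition proj_fun :: "(real ^ 'n) set \<Rightarrow> (real ^ 'n \<Rightarrow> real) \<Rightarrow> real ^ 'n \<Rightarrow> real" where
  "proj_fun E f = (\<lambda>y\<in>E. INF z\<in>E\<^sup>\<bottom>. f (y + z))"

definition beta_const :: "nat \<Rightarrow> nat \<Rightarrow> real" where
  "beta_const j n =
    real (n choose j) * (unit_ball_vol (real n) / (unit_ball_vol (real j) * unit_ball_vol (real (n - j))))"

definition sigma_const :: "nat \<Rightarrow> nat \<Rightarrow> real" where
  "sigma_const j n = unit_ball_vol (real n) / unit_ball_vol (real (n - j))"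

text \<open>
  The integrands are nonnegative, so the integrals are taken in \<open>[0, \<infinity>]\<close>. The parameter \<open>\<nu>\<close> is the
  family of Haar measures \<open>\<nu>\<^sub>j\<close>; it is not used for \<open>j = n\<close>.
\<close>
definition V_top :: "nat \<Rightarrow> (real ^ 'n \<Rightarrow> real) \<Rightarrow> ennreal" where
  "V_top d f =
    ennreal (1 / Gamma (1 + real CARD('n) / real d)) * (\<integral>\<^sup>+ x. ennreal (exp (- f x)) \<partial>lborel)"

definition V_proj ::
  "nat \<Rightarrow> (nat \<Rightarrow> (real ^ 'n) set measure) \<Rightarrow> nat \<Rightarrow> (real ^ 'n \<Rightarrow> real) \<Rightarrow> ennreal" where
  "V_proj d \<nu> j f =
    (if f \<notin> pos_hom_poly d then \<infinity>
     else if j = CARD('n) then V_top d f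
     else ennreal (beta_const j CARD('n) / Gamma (1 + real j / real d)) *
       (\<integral>\<^sup>+ E. (\<integral>\<^sup>+ y. ennreal (exp (- proj_fun E f y)) \<partial>subspace_lborel E) \<partial>\<nu> j))"

definition V_restr ::
  "nat \<Rightarrow> (nat \<Rightarrow> (real ^ 'n) set measure) \<Rightarrow> nat \<Rightarrow> (real ^ 'n \<Rightarrow> real) \<Rightarrow> ennreal" where
  "V_restr d \<nu> j f =
    (if f \<notin> pos_hom_poly d then \<infinity>
     else if j = CARD('n) then V_top d f
     else ennreal (sigma_const j CARD('n) / Gamma (1 + real j / real d)) *
       (\<integral>\<^sup>+ E. (\<integral>\<^sup>+ y. ennreal (exp (- restrict f E y)) \<partial>subspace_lborel E) \<partial>\<nu> j))"

definition lower_semicontinuous_map :: "'a topology \<Rightarrow> ('a \<Rightarrow> 'b::linorder) \<Rightarrow> bool" where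
  "lower_semicontinuous_map X F \<longleftrightarrow> (\<forall>t. openin X {x \<in> topspace X. t < F x})"

end

theory Submission
  imports Defs
begin

text \<open>
  If \<open>g\<close> is uniformly close to \<open>f > 0\<close> on the sphere, then \<open>g \<le> c ^ d * f\<close> everywhere, for a given
  \<open>c > 1\<close>. Both integrands are monotone in \<open>f\<close>, and by homogeneity multiplying \<open>f\<close> by \<open>c ^ d\<close> amounts
  to dilating the \<open>j\<close>-dimensional domain of integration by \<open>c\<close>, so the functional at \<open>g\<close> is at least
  \<open>c ^ (- j)\<close> times its value at \<open>f\<close>. Letting \<open>c\<close> tend to \<open>1\<close> gives lower semicontinuity. Only a
  constant factor is pulled out of the integral over the Grassmannian, so the measurability of the
  inner integral as a function of \<open>E\<close> plays no role.
\<close>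

section \<open>Positive homogeneous polynomials\<close>

lemma hom_poly_scale: "f \<in> hom_poly d \<Longrightarrow> c > 0 \<Longrightarrow> f (c *\<^sub>R x) = c ^ d * f x"
  by (auto simp: hom_poly_def)

text \<open>Homogeneity is assumed only for positive factors, so the value at the origin needs its
  own argument: the factor 2 gives \<open>f 0 = 2 ^ d * f 0\<close>, and \<open>2 ^ d\<close>
  differs from 1.\<close>

lemma hom_poly_0:
  assumes "f \<in> hom_poly d" "d > 0"
  shows "f 0 = 0"
proof -
  have "f 0 = 2 ^ d * f 0"
    using hom_poly_scale[OF assms(1), of 2 0] by simp
  moreover have "(2::real) ^ d \<noteq> 1"
    using assms(2) one_less_power[of "2::real" d] by linarith
  ultimately show ?thesis by simp
qed

lemma pos_hom_poly_nonneg: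
  assumes "f \<in> pos_hom_poly d" "d > 0"
  shows "0 \<le> f x"
  using assms hom_poly_0[of f d] by (cases "x = 0") (auto simp: pos_hom_poly_def less_imp_le)

lemma pos_hom_poly_sphere_lower_bound:
  fixes f :: "real ^ 'n \<Rightarrow> real"
  assumes "f \<in> pos_hom_poly d"
  obtains m where "m > 0" "\<And>x. norm x = 1 \<Longrightarrow> m \<le> f x"
proof -
  have "f \<in> hom_poly d" using assms by (simp add: pos_hom_poly_def)
  then obtain x where "x \<in> sphere 0 1" "\<And>y. y \<in> sphere 0 1 \<Longrightarrow> f x \<le> f y"
    using continuous_attains_inf[OF compact_sphere sphere_vec_nonempty hom_poly_continuous_on]
    by blast
  with assms show ?thesis
    by (intro that[of "f x"]) (auto simp: pos_hom_poly_def dest: spec[of _ x])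
qed

text \<open>With \<open>m\<close> a positive lower bound of \<open>f\<close> on the sphere,
  \<open>c ^ d * f\<close> exceeds \<open>f\<close> there by at least
  \<open>(c ^ d - 1) * m\<close>. Any \<open>g\<close> closer to \<open>f\<close> than this margin
  stays below \<open>c ^ d * f\<close> on the sphere, and homogeneity of both sides extends the
  bound to all nonzero points.\<close>

lemma sphere_dist_imp_le:
  fixes f g :: "real ^ 'n \<Rightarrow> real"
  assumes f: "f \<in> pos_hom_poly d" and d: "d > 0" and c: "c > (1::real)"
  obtains e where "e > 0"
    "\<And>g x. g \<in> hom_poly d \<Longrightarrow> sphere_dist d f g < e \<Longrightarrow> g x \<le> c ^ d * f x"
proof -
  obtain m where m: "m > 0" "\<And>x. norm x = 1 \<Longrightarrow> m \<le> f x"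
    using pos_hom_poly_sphere_lower_bound[OF f] by blast
  have fh: "f \<in> hom_poly d" using f by (simp add: pos_hom_poly_def)
  have cd: "c ^ d - 1 > 0" using one_less_power[OF c d] by simp
  show ?thesis
  proof (rule that)
    show "(c ^ d - 1) * m > 0" using cd m by simp
    fix g :: "real ^ 'n \<Rightarrow> real" and x
    assume g: "g \<in> hom_poly d" and lt: "sphere_dist d f g < (c ^ d - 1) * m"
    show "g x \<le> c ^ d * f x"
    proof (cases "x = 0")
      case True
      then show ?thesis using hom_poly_0[OF g d] hom_poly_0[OF fh d] by simp
    next
      case False
      define u where "u = x /\<^sub>R norm x"
      have u: "norm x *\<^sub>R u = x" "norm u = 1" and p: "norm x > 0"
        using False by (auto simp: u_def)
      have "\<bar>f u - g u\<bar> \<le> (c ^ d - 1) * f u"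
        using abs_diff_le_sphere_dist[OF fh g u(2)] lt
          mult_left_mono[OF m(2)[OF u(2)], of "c ^ d - 1"] cd by linarith
      then have "g u \<le> c ^ d * f u" by (simp add: algebra_simps)
      then have "norm x ^ d * g u \<le> norm x ^ d * (c ^ d * f u)"
        by (intro mult_left_mono) auto
      then show ?thesis
        using hom_poly_scale[OF g p, of u] hom_poly_scale[OF fh p, of u] u(1)
        by (simp add: mult_ac)
    qed
  qed
qed

text \<open>The dilation inequality is the only property of \<open>V\<close> that enters, so one
  argument serves both families of functionals. If \<open>t < V f\<close>, some \<open>c > 1\<close>
  still satisfies \<open>t < V f / c ^ j\<close>, and a ball on which
  \<open>g \<le> c ^ d * f\<close> then lies in the superlevel set.\<close>

lemma lower_semicontinuous_map_pos_hom_poly: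
  fixes V :: "(real ^ 'n \<Rightarrow> real) \<Rightarrow> ennreal"
  assumes d: "d > 0"
    and V: "\<And>f g c. f \<in> pos_hom_poly d \<Longrightarrow> g \<in> pos_hom_poly d \<Longrightarrow> c > 1 \<Longrightarrow>
      (\<And>x. g x \<le> c ^ d * f x) \<Longrightarrow> ennreal (1 / c ^ j) * V f \<le> V g"
  shows "lower_semicontinuous_map (subtopology (hom_poly_topology d) (pos_hom_poly d)) V"
proof -
  interpret Metric_space "hom_poly d" "sphere_dist d" by (rule Metric_space_hom_poly)
  have sub: "pos_hom_poly d \<subseteq> hom_poly d" by (auto simp: pos_hom_poly_def)
  \<comment> \<open>The subspace topology is the metric topology of the restricted distance, so
    openness can be tested on balls inside \<open>pos_hom_poly d\<close>.\<close>
  interpret S: Submetric "hom_poly d" "sphere_dist d" "pos_hom_poly d"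
    by unfold_locales (use sub in auto)
  have "openin S.sub.mtopology {f \<in> pos_hom_poly d. t < V f}" for t
    unfolding S.sub.openin_mtopology
  proof (intro conjI allI impI)
    fix f assume "f \<in> {f \<in> pos_hom_poly d. t < V f}"
    then have f: "f \<in> pos_hom_poly d" and t: "t < V f" by auto
    obtain c :: real where c: "c > 1" "t < ennreal (1 / c ^ j) * V f"
    \<comment> \<open>An infinite value stays infinite under any positive factor, so
      \<open>c = 2\<close> will do. A finite value allows passing to the limit as \<open>c\<close>
      decreases to 1.\<close>
    proof (cases "V f = top")
      case True
      with t show ?thesis by (intro that[of 2]) (simp_all add: ennreal_mult_top)
    next
      case False
      have "((\<lambda>c. V f * ennreal (1 / c ^ j)) \<longlongrightarrow> V f * ennreal (1 / 1 ^ j)) (at_right (1::real))"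
        using False by (intro ennreal_tendsto_cmult tendsto_ennrealI tendsto_intros) (auto simp: less_top)
      then have "eventually (\<lambda>c. t < V f * ennreal (1 / c ^ j)) (at_right (1::real))"
        using t by (intro order_tendstoD(1)) auto
      then have "eventually (\<lambda>c. t < V f * ennreal (1 / c ^ j) \<and> c > 1) (at_right (1::real))"
        by (intro eventually_conj eventually_at_right_less)
      then show ?thesis
        using that eventually_happens[of _ "at_right (1::real)"] by (auto simp: mult.commute)
    qed
    obtain e where e: "e > 0"
      "\<And>g x. g \<in> hom_poly d \<Longrightarrow> sphere_dist d f g < e \<Longrightarrow> g x \<le> c ^ d * f x"
      using sphere_dist_imp_le[OF f d c(1)] by blast
    have "S.sub.mball f e \<subseteq> {f \<in> pos_hom_poly d. t < V f}"
    proof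
      fix g assume "g \<in> S.sub.mball f e"
      then have g: "g \<in> pos_hom_poly d" "sphere_dist d f g < e" by auto
      then have "ennreal (1 / c ^ j) * V f \<le> V g"
        using e(2) sub by (intro V[OF f g(1) c(1)]) auto
      with c(2) g(1) show "g \<in> {f \<in> pos_hom_poly d. t < V f}" by auto
    qed
    with e(1) show "\<exists>r>0. S.sub.mball f r \<subseteq> {f \<in> pos_hom_poly d. t < V f}" by blast
  qed auto
  moreover have "{f \<in> topspace (subtopology (hom_poly_topology d) (pos_hom_poly d)). t < V f} =
      {f \<in> pos_hom_poly d. t < V f}" for t
    using sub by auto
  ultimately show ?thesis
    by (simp only: lower_semicontinuous_map_def hom_poly_topology_def S.mtopology_submetric simp_thms)
qed

section \<open>Dilations and Lebesgue integrals\<close>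

text \<open>The integral of \<open>F\<close> is a supremum over simple functions
  \<open>s \<le> F\<close>, and each \<open>r * s\<close> is a simple function below
  \<open>r * F\<close>. This direction is what moves the dilation factor inside the integral over
  the Grassmannian.\<close>

lemma nn_integral_cmult_le:
  assumes "r < \<infinity>"
  shows "r * (\<integral>\<^sup>+ x. F x \<partial>M) \<le> (\<integral>\<^sup>+ x. r * F x \<partial>M)"
proof -
  have "r * integral\<^sup>S M s \<le> (\<integral>\<^sup>+ x. r * F x \<partial>M)" if "simple_function M s" "s \<le> F" for s
  proof -
    have "r * integral\<^sup>S M s = (\<integral>\<^sup>S x. r * s x \<partial>M)"
      using that(1) by simp
    also have "\<dots> = (\<integral>\<^sup>+ x. r * s x \<partial>M)"
      using that(1) by (intro nn_integral_eq_simple_integral[symmetric]) auto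
    also have "\<dots> \<le> (\<integral>\<^sup>+ x. r * F x \<partial>M)"
      using that(2) by (intro nn_integral_mono mult_left_mono) (auto simp: le_fun_def)
    finally show ?thesis .
  qed
  then show ?thesis
    unfolding nn_integral_def[of M F]
    by (auto simp: SUP_mult_left_ennreal intro!: SUP_least)
qed

lemma emeasure_lborel_vimage_times:
  assumes "c > (0::real)" "A \<in> sets borel"
  shows "ennreal c * emeasure lborel ((\<lambda>x. c * x) -` A) = emeasure lborel A"
proof -
  have "emeasure lborel A = emeasure (density (distr lborel borel (\<lambda>x. 0 + c * x)) (\<lambda>_. ennreal \<bar>c\<bar>)) A"
    using lborel_real_affine[of c 0] assms by auto
  also have "\<dots> = ennreal c * emeasure lborel ((\<lambda>x. c * x) -` A)"
    using assms by (subst emeasure_density_const) (auto simp: emeasure_distr)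
  finally show ?thesis ..
qed

text \<open>A product measure is determined by its values on boxes. The preimage of a box under the
  dilation is again a box, and each of its \<open>card B\<close> sides contributes one factor
  \<open>c\<close>.\<close>

lemma PiM_lborel_dilation:
  assumes "finite B" "c > 0"
  shows "density (distr (\<Pi>\<^sub>M b\<in>B. lborel) (\<Pi>\<^sub>M b\<in>B. lborel) (\<lambda>x. \<lambda>b\<in>B. c * x b))
    (\<lambda>_. ennreal (c ^ card B)) = (\<Pi>\<^sub>M b\<in>B. (lborel :: real measure))"
proof -
  interpret product_sigma_finite "\<lambda>_. lborel :: real measure" ..
  interpret finite_product_sigma_finite "\<lambda>_. lborel :: real measure" B
    by unfold_locales fact
  have meas: "(\<lambda>x. \<lambda>b\<in>B. c * x b) \<in> (\<Pi>\<^sub>M b\<in>B. lborel) \<rightarrow>\<^sub>M (\<Pi>\<^sub>M b\<in>B. (lborel :: real measure))"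
    by measurable
  show ?thesis
  proof (rule PiM_eqI)
    fix A :: "'a \<Rightarrow> real set"
    assume A: "\<And>i. i \<in> B \<Longrightarrow> A i \<in> sets lborel"
    have PA: "Pi\<^sub>E B A \<in> sets (\<Pi>\<^sub>M b\<in>B. (lborel :: real measure))"
      using A assms by (intro sets_PiM_I_finite) auto
    have "(\<lambda>x. \<lambda>b\<in>B. c * x b) -` Pi\<^sub>E B A \<inter> space (\<Pi>\<^sub>M b\<in>B. (lborel :: real measure))
        = Pi\<^sub>E B (\<lambda>b. (\<lambda>x. c * x) -` A b)"
      by (auto simp: space_PiM PiE_iff)
    moreover have "(\<lambda>x. c * x) -` A i \<in> sets lborel" if "i \<in> B" for i
      using measurable_sets[of "\<lambda>x. c * x" borel borel "A i"] A[OF that] by auto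
    ultimately show "emeasure (density (distr (\<Pi>\<^sub>M b\<in>B. lborel) (\<Pi>\<^sub>M b\<in>B. lborel)
        (\<lambda>x. \<lambda>b\<in>B. c * x b)) (\<lambda>_. ennreal (c ^ card B))) (Pi\<^sub>E B A)
        = (\<Prod>i\<in>B. emeasure lborel (A i))"
      using A assms PA
      by (simp add: emeasure_density_const emeasure_distr[OF meas] emeasure_PiM
          emeasure_lborel_vimage_times[OF assms(2), symmetric] prod.distrib ennreal_power
          cong: prod.cong)
  qed (use assms in auto)
qed

lemma nn_integral_PiM_lborel_dilation:
  assumes "finite B" "c > 0" and [measurable]: "h \<in> borel_measurable (\<Pi>\<^sub>M b\<in>B. lborel)"
  shows "(\<integral>\<^sup>+ x. h (\<lambda>b\<in>B. c * x b) \<partial>(\<Pi>\<^sub>M b\<in>B. lborel))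
    = ennreal (1 / c ^ card B) * (\<integral>\<^sup>+ x. h x \<partial>(\<Pi>\<^sub>M b\<in>B. (lborel :: real measure)))"
proof -
  have meas[measurable]:
    "(\<lambda>x. \<lambda>b\<in>B. c * x b) \<in> (\<Pi>\<^sub>M b\<in>B. lborel) \<rightarrow>\<^sub>M (\<Pi>\<^sub>M b\<in>B. (lborel :: real measure))"
    by measurable
  have "(\<integral>\<^sup>+ x. h x \<partial>(\<Pi>\<^sub>M b\<in>B. (lborel :: real measure)))
      = ennreal (c ^ card B) * (\<integral>\<^sup>+ x. h (\<lambda>b\<in>B. c * x b) \<partial>(\<Pi>\<^sub>M b\<in>B. lborel))"
    by (subst PiM_lborel_dilation[OF assms(1,2), symmetric])
       (simp add: nn_integral_density nn_integral_distr nn_integral_cmult)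
  moreover have "ennreal (1 / c ^ card B) * ennreal (c ^ card B) = 1"
    using assms(2) by (simp flip: ennreal_mult)
  ultimately show ?thesis
    by (simp flip: mult.assoc)
qed

lemma nn_integral_lborel_dilation:
  fixes h :: "'a::euclidean_space \<Rightarrow> ennreal"
  assumes "c > 0" and [measurable]: "h \<in> borel_measurable borel"
  shows "(\<integral>\<^sup>+ x. h (c *\<^sub>R x) \<partial>lborel) = ennreal (1 / c ^ DIM('a)) * (\<integral>\<^sup>+ x. h x \<partial>lborel)"
proof -
  have "(\<integral>\<^sup>+ x. h x \<partial>lborel) = ennreal (c ^ DIM('a)) * (\<integral>\<^sup>+ x. h (c *\<^sub>R x) \<partial>lborel)"
    using assms(1)
    by (subst lborel_affine[of c 0]) (simp_all add: nn_integral_density nn_integral_distr nn_integral_cmult)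
  moreover have "ennreal (1 / c ^ DIM('a)) * ennreal (c ^ DIM('a)) = 1"
    using assms(1) by (simp flip: ennreal_mult)
  ultimately show ?thesis
    by (simp flip: mult.assoc)
qed

text \<open>Gram-Schmidt provides a witness for the choice operator. Unit vectors are nonzero, so
  pairwise orthogonality gives independence, and the cardinality is the dimension.\<close>

lemma orthonormal_basis:
  fixes E :: "(real ^ 'n) set"
  assumes "subspace E"
  shows "finite (orthonormal_basis E)" "card (orthonormal_basis E) = dim E"
    "span (orthonormal_basis E) = E"
proof -
  let ?P = "\<lambda>B. pairwise orthogonal B \<and> (\<forall>b\<in>B. norm b = 1) \<and> span B = E"
  have "?P (orthonormal_basis E)"
    unfolding orthonormal_basis_def
    by (rule someI_ex, rule orthonormal_basis_subspace[OF assms]) blast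
  then have B: "pairwise orthogonal (orthonormal_basis E)" "0 \<notin> orthonormal_basis E"
    "span (orthonormal_basis E) = E" by auto
  then have "independent (orthonormal_basis E)"
    by (intro pairwise_orthogonal_independent)
  then show "finite (orthonormal_basis E)" "card (orthonormal_basis E) = dim E"
    using B(3) dim_span_eq_card_independent[of "orthonormal_basis E"]
    by (auto simp: independent_imp_finite)
  show "span (orthonormal_basis E) = E" by fact
qed

lemma space_subspace_lborel [simp]: "space (subspace_lborel E) = E"
  by (simp add: subspace_lborel_def space_restrict_space)

text \<open>In coordinates with respect to the chosen orthonormal basis, the dilation of
  \<open>E\<close> acts on each coordinate separately, which reduces the claim to the product
  measure with \<open>dim E\<close> factors.\<close>

lemma nn_integral_subspace_lborel_dilation:
  fixes E :: "(real ^ 'n) set"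
  assumes E: "subspace E" and c: "c > 0" and h: "h \<in> borel_measurable (restrict_space borel E)"
  shows "(\<integral>\<^sup>+ y. h (c *\<^sub>R y) \<partial>subspace_lborel E)
    = ennreal (1 / c ^ dim E) * (\<integral>\<^sup>+ y. h y \<partial>subspace_lborel E)"
proof -
  let ?B = "orthonormal_basis E"
  let ?L = "\<lambda>x. \<Sum>b\<in>?B. x b *\<^sub>R b"
  note B = orthonormal_basis[OF E]
  have "(\<Sum>b\<in>?B. x b *\<^sub>R b) \<in> E" for x
    using B(3) by (metis (no_types, lifting) span_base span_scale span_sum)
  then have L: "?L \<in> (\<Pi>\<^sub>M b\<in>?B. lborel) \<rightarrow>\<^sub>M restrict_space borel E"
    by (intro measurable_restrict_space2) auto
  have "(\<lambda>y. c *\<^sub>R y) \<in> restrict_space borel E \<rightarrow>\<^sub>M restrict_space borel E"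
    by (intro measurable_restrict_space2 measurable_restrict_space1)
       (auto simp: space_restrict_space subspace_scale[OF E])
  then have hc: "(\<lambda>y. h (c *\<^sub>R y)) \<in> borel_measurable (restrict_space borel E)"
    using h by (rule measurable_compose)
  have "(\<integral>\<^sup>+ y. h (c *\<^sub>R y) \<partial>subspace_lborel E) = (\<integral>\<^sup>+ x. h (c *\<^sub>R ?L x) \<partial>(\<Pi>\<^sub>M b\<in>?B. lborel))"
    unfolding subspace_lborel_def using hc by (intro nn_integral_distr[OF L]) simp
  \<comment> \<open>Linearity moves \<open>c\<close> into the coordinates; \<open>?L\<close> reads
    only coordinates in \<open>?B\<close>, so the restricted function gives the same sum.\<close>
  also have "\<dots> = (\<integral>\<^sup>+ x. h (?L (\<lambda>b\<in>?B. c * x b)) \<partial>(\<Pi>\<^sub>M b\<in>?B. lborel))"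
    by (simp add: scaleR_sum_right cong: sum.cong)
  also have "\<dots> = ennreal (1 / c ^ dim E) * (\<integral>\<^sup>+ x. h (?L x) \<partial>(\<Pi>\<^sub>M b\<in>?B. lborel))"
    using nn_integral_PiM_lborel_dilation[OF B(1) c measurable_compose[OF L h]] B(2) by simp
  also have "(\<integral>\<^sup>+ x. h (?L x) \<partial>(\<Pi>\<^sub>M b\<in>?B. lborel)) = (\<integral>\<^sup>+ y. h y \<partial>subspace_lborel E)"
    unfolding subspace_lborel_def using h by (intro nn_integral_distr[OF L, symmetric]) simp
  finally show ?thesis .
qed

section \<open>Restrictions and projections of homogeneous polynomials\<close>

text \<open>An infimum of reals is informative only for a set bounded below; nonnegativity of
  \<open>f\<close> supplies the bound 0 for all the infima that follow.\<close>

lemma bdd_below_proj_fun: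
  "(\<And>x. 0 \<le> f x) \<Longrightarrow> bdd_below ((\<lambda>z. f (y + z)) ` A)" for f :: "real ^ 'n \<Rightarrow> real"
  by (auto intro!: bdd_belowI2[where m = 0])

lemma orthogonal_comp_nonempty: "(E :: (real ^ 'n) set)\<^sup>\<bottom> \<noteq> {}"
  using subspace_0[OF subspace_orthogonal_comp] by blast

lemma proj_fun_mono:
  assumes "\<And>x. 0 \<le> g x" "\<And>x. g x \<le> f x" "y \<in> E"
  shows "proj_fun E g y \<le> proj_fun E f y"
  using assms orthogonal_comp_nonempty[of E]
  by (auto simp: proj_fun_def intro!: cINF_mono bdd_below_proj_fun)

text \<open>An infimum of continuous functions is upper semicontinuous.\<close>
lemma borel_measurable_proj_fun:
  fixes f :: "real ^ 'n \<Rightarrow> real"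
  assumes f: "continuous_on UNIV f" and nn: "\<And>x. 0 \<le> f x"
  shows "proj_fun E f \<in> borel_measurable (restrict_space borel E)"
  unfolding borel_measurable_iff_less
proof
  fix a
  have "{y \<in> space (restrict_space borel E). proj_fun E f y < a} = (\<Union>z\<in>E\<^sup>\<bottom>. {y. f (y + z) < a}) \<inter> E"
    by (auto simp: space_restrict_space proj_fun_def
        cINF_less_iff[OF orthogonal_comp_nonempty bdd_below_proj_fun[of f, OF nn]])
  moreover have "open (\<Union>z\<in>E\<^sup>\<bottom>. {y. f (y + z) < a})"
    by (intro open_UN ballI open_Collect_less continuous_intros continuous_on_compose2[OF f]) auto
  ultimately show "{y \<in> space (restrict_space borel E). proj_fun E f y < a} \<in> sets (restrict_space borel E)"
    by (auto simp: sets_restrict_space Int_commute)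
qed

text \<open>Multiplication by \<open>r \<ge> 0\<close> is monotone and continuous, so it commutes
  with the infimum of a nonempty set that is bounded below.\<close>

lemma proj_fun_mult:
  fixes f :: "real ^ 'n \<Rightarrow> real"
  assumes nn: "\<And>x. 0 \<le> f x" and r: "r \<ge> 0" and y: "y \<in> E"
  shows "proj_fun E (\<lambda>x. r * f x) y = r * proj_fun E f y"
proof -
  have "r * (INF z\<in>E\<^sup>\<bottom>. f (y + z)) = (INF z\<in>E\<^sup>\<bottom>. r * f (y + z))"
    using r bdd_below_proj_fun[of f, OF nn] orthogonal_comp_nonempty[of E]
    by (subst continuous_at_Inf_mono[where f = "\<lambda>x. r * x"])
       (auto simp: mono_def image_image intro!: continuous_intros mult_left_mono)
  then show ?thesis using y by (simp add: proj_fun_def)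
qed

text \<open>The orthogonal complement is mapped onto itself by \<open>z \<mapsto> c z\<close>.
  Substituting \<open>c z\<close> for \<open>z\<close> in the infimum lets homogeneity of
  \<open>f\<close> act on the whole argument \<open>y + z\<close>.\<close>

lemma proj_fun_scale:
  fixes f :: "real ^ 'n \<Rightarrow> real"
  assumes f: "f \<in> hom_poly d" and nn: "\<And>x. 0 \<le> f x" and E: "subspace E" and c: "c > 0" and y: "y \<in> E"
  shows "proj_fun E f (c *\<^sub>R y) = c ^ d * proj_fun E f y"
proof -
  have surj: "(\<lambda>z. c *\<^sub>R z) ` (E\<^sup>\<bottom>) = E\<^sup>\<bottom>"
  proof (intro subset_antisym subsetI)
    fix z assume "z \<in> E\<^sup>\<bottom>"
    then have "(1 / c) *\<^sub>R z \<in> E\<^sup>\<bottom>" "z = c *\<^sub>R (1 / c) *\<^sub>R z"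
      using c by (auto intro: subspace_scale[OF subspace_orthogonal_comp])
    then show "z \<in> (\<lambda>z. c *\<^sub>R z) ` (E\<^sup>\<bottom>)" by blast
  qed (auto intro: subspace_scale[OF subspace_orthogonal_comp])
  have "(INF z\<in>E\<^sup>\<bottom>. f (c *\<^sub>R y + z)) = (INF z\<in>E\<^sup>\<bottom>. f (c *\<^sub>R y + c *\<^sub>R z))"
    by (subst surj[symmetric]) (simp add: image_image)
  also have "\<dots> = (INF z\<in>E\<^sup>\<bottom>. c ^ d * f (y + z))"
    by (simp add: hom_poly_scale[OF f c] flip: scaleR_add_right)
  finally show ?thesis
    using y E proj_fun_mult[of f "c ^ d" y E, OF nn] c by (simp add: proj_fun_def subspace_scale)
qed

section \<open>Lower semicontinuity\<close>

lemma space_grassmannian_haar: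
  assumes "grassmannian_haar j \<nu>"
  shows "space \<nu> = grassmannian j"
proof -
  have "space \<nu> = space (grassmannian_borel j)"
    using assms by (intro sets_eq_imp_space_eq) (simp add: grassmannian_haar_def)
  then show ?thesis by (simp add: grassmannian_borel_def)
qed

text \<open>The dilated integral has integrand \<open>exp (- (c ^ d * f x))\<close>, which is at
  most \<open>exp (- g x)\<close> because the exponential reverses the inequality.\<close>

lemma V_top_dilation_le:
  fixes f g :: "real ^ 'n \<Rightarrow> real"
  assumes f: "f \<in> hom_poly d" and c: "c > 0" and le: "\<And>x. g x \<le> c ^ d * f x"
  shows "ennreal (1 / c ^ CARD('n)) * V_top d f \<le> V_top d g"
proof -
  have [measurable]: "f \<in> borel_measurable borel"
    by (rule borel_measurable_continuous_onI[OF hom_poly_continuous_on[OF f]])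
  have "ennreal (1 / c ^ CARD('n)) * (\<integral>\<^sup>+ x. ennreal (exp (- f x)) \<partial>lborel)
      = (\<integral>\<^sup>+ x. ennreal (exp (- f (c *\<^sub>R x))) \<partial>lborel)"
    by (subst nn_integral_lborel_dilation[OF c]) auto
  also have "\<dots> \<le> (\<integral>\<^sup>+ x. ennreal (exp (- g x)) \<partial>lborel)"
    using le by (intro nn_integral_mono) (simp add: hom_poly_scale[OF f c])
  finally show ?thesis
    unfolding V_top_def by (subst mult.left_commute) (rule mult_left_mono, auto)
qed

text \<open>Here \<open>p\<close> and \<open>q\<close> stand for the projections or the restrictions
  of two polynomials. Every \<open>E\<close> in the space of the measure has dimension
  \<open>j\<close>, so the inner integrals all scale by the same factor, which can be compared with
  the outer integral.\<close>

lemma grassmannian_integral_dilation_le: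
  fixes p q :: "(real ^ 'n) set \<Rightarrow> real ^ 'n \<Rightarrow> real"
  assumes \<nu>: "space \<nu> = grassmannian j" and c: "c > 0"
    and p: "\<And>E. subspace E \<Longrightarrow> p E \<in> borel_measurable (restrict_space borel E)"
    and scale: "\<And>E y. subspace E \<Longrightarrow> y \<in> E \<Longrightarrow> p E (c *\<^sub>R y) = c ^ d * p E y"
    and le: "\<And>E y. subspace E \<Longrightarrow> y \<in> E \<Longrightarrow> q E y \<le> c ^ d * p E y"
  shows "ennreal (1 / c ^ j) * (K * (\<integral>\<^sup>+ E. (\<integral>\<^sup>+ y. ennreal (exp (- p E y)) \<partial>subspace_lborel E) \<partial>\<nu>))
    \<le> K * (\<integral>\<^sup>+ E. (\<integral>\<^sup>+ y. ennreal (exp (- q E y)) \<partial>subspace_lborel E) \<partial>\<nu>)"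
proof -
  have inner: "ennreal (1 / c ^ j) * (\<integral>\<^sup>+ y. ennreal (exp (- p E y)) \<partial>subspace_lborel E)
      \<le> (\<integral>\<^sup>+ y. ennreal (exp (- q E y)) \<partial>subspace_lborel E)" if "E \<in> space \<nu>" for E
  proof -
    have E: "subspace E" "dim E = j" using that \<nu> by (auto simp: grassmannian_def)
    have [measurable]: "p E \<in> borel_measurable (restrict_space borel E)" by (rule p[OF E(1)])
    have "ennreal (1 / c ^ j) * (\<integral>\<^sup>+ y. ennreal (exp (- p E y)) \<partial>subspace_lborel E)
        = (\<integral>\<^sup>+ y. ennreal (exp (- p E (c *\<^sub>R y))) \<partial>subspace_lborel E)"
      by (subst nn_integral_subspace_lborel_dilation[OF E(1) c, where h = "\<lambda>y. ennreal (exp (- p E y))"])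
         (use E in auto)
    also have "\<dots> \<le> (\<integral>\<^sup>+ y. ennreal (exp (- q E y)) \<partial>subspace_lborel E)"
      using le E(1) by (intro nn_integral_mono) (simp add: scale)
    finally show ?thesis .
  qed
  have "ennreal (1 / c ^ j) * (\<integral>\<^sup>+ E. (\<integral>\<^sup>+ y. ennreal (exp (- p E y)) \<partial>subspace_lborel E) \<partial>\<nu>)
      \<le> (\<integral>\<^sup>+ E. ennreal (1 / c ^ j) * (\<integral>\<^sup>+ y. ennreal (exp (- p E y)) \<partial>subspace_lborel E) \<partial>\<nu>)"
    by (rule nn_integral_cmult_le) simp
  also have "\<dots> \<le> (\<integral>\<^sup>+ E. (\<integral>\<^sup>+ y. ennreal (exp (- q E y)) \<partial>subspace_lborel E) \<partial>\<nu>)"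
    by (intro nn_integral_mono inner)
  finally show ?thesis
    by (subst mult.left_commute) (rule mult_left_mono, auto)
qed

lemma V_proj_dilation_le:
  fixes f g :: "real ^ 'n \<Rightarrow> real"
  assumes \<nu>: "j < CARD('n) \<Longrightarrow> space (\<nu> j) = grassmannian j" and j: "j \<le> CARD('n)" and d: "d > 0"
    and f: "f \<in> pos_hom_poly d" and g: "g \<in> pos_hom_poly d"
    and c: "c > 0" and le: "\<And>x. g x \<le> c ^ d * f x"
  shows "ennreal (1 / c ^ j) * V_proj d \<nu> j f \<le> V_proj d \<nu> j g"
proof (cases "j = CARD('n)")
  case True
  then show ?thesis
    using f g V_top_dilation_le[of f d c g, OF _ c le] by (simp add: V_proj_def pos_hom_poly_def)
next
  case False
  have fh: "f \<in> hom_poly d" using f by (simp add: pos_hom_poly_def)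
  note nn = pos_hom_poly_nonneg[OF f d] pos_hom_poly_nonneg[OF g d]
  \<comment> \<open>The pointwise bound passes to the infima over each fibre \<open>y + z\<close>,
    and the constant is then pulled out.\<close>
  have "proj_fun E g y \<le> c ^ d * proj_fun E f y" if "subspace E" "y \<in> E" for E y
  proof -
    have "proj_fun E g y \<le> proj_fun E (\<lambda>x. c ^ d * f x) y"
      using le that by (intro proj_fun_mono nn)
    also have "\<dots> = c ^ d * proj_fun E f y"
      using nn(1) c that by (intro proj_fun_mult) auto
    finally show ?thesis .
  qed
  then show ?thesis
    using False f g j
    by (simp add: V_proj_def grassmannian_integral_dilation_le[where d = d] \<nu> c
        borel_measurable_proj_fun hom_poly_continuous_on[OF fh] nn proj_fun_scale[OF fh])
qed

lemma V_restr_dilation_le: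
  fixes f g :: "real ^ 'n \<Rightarrow> real"
  assumes \<nu>: "j < CARD('n) \<Longrightarrow> space (\<nu> j) = grassmannian j" and j: "j \<le> CARD('n)"
    and f: "f \<in> pos_hom_poly d" and g: "g \<in> pos_hom_poly d"
    and c: "c > 0" and le: "\<And>x. g x \<le> c ^ d * f x"
  shows "ennreal (1 / c ^ j) * V_restr d \<nu> j f \<le> V_restr d \<nu> j g"
proof (cases "j = CARD('n)")
  case True
  then show ?thesis
    using f g V_top_dilation_le[of f d c g, OF _ c le] by (simp add: V_restr_def pos_hom_poly_def)
next
  case False
  have fh: "f \<in> hom_poly d" using f by (simp add: pos_hom_poly_def)
  \<comment> \<open>Outside \<open>E\<close> the restricted function takes a default value, but the
    underlying space is \<open>E\<close>, where it agrees with the continuous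
    \<open>f\<close>.\<close>
  have meas: "restrict f E \<in> borel_measurable (restrict_space borel E)" for E
  proof -
    have "f \<in> borel_measurable (restrict_space borel E)"
      by (intro measurable_restrict_space1 borel_measurable_continuous_onI hom_poly_continuous_on[OF fh])
    then show ?thesis
      by (rule measurable_cong[THEN iffD2, rotated]) (simp add: space_restrict_space)
  qed
  have "ennreal (1 / c ^ j) *
      (K * (\<integral>\<^sup>+ E. (\<integral>\<^sup>+ y. ennreal (exp (- restrict f E y)) \<partial>subspace_lborel E) \<partial>\<nu> j))
      \<le> K * (\<integral>\<^sup>+ E. (\<integral>\<^sup>+ y. ennreal (exp (- restrict g E y)) \<partial>subspace_lborel E) \<partial>\<nu> j)" for K
    using False j le
    by (intro grassmannian_integral_dilation_le[where d = d] \<nu> c meas)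
       (auto simp: hom_poly_scale[OF fh c] subspace_scale)
  then show ?thesis
    using False f g by (simp add: V_restr_def)
qed

theorem corollary4p2:
  fixes d j :: nat and \<nu> :: "nat \<Rightarrow> (real ^ 'n) set measure"
  assumes "CARD('n) \<ge> 2" and "d \<ge> 2" and "even d"
    and "\<And>i. 1 \<le> i \<Longrightarrow> i < CARD('n) \<Longrightarrow> grassmannian_haar i (\<nu> i)"
    and "1 \<le> j" and "j \<le> CARD('n)"
  shows "lower_semicontinuous_map
           (subtopology (hom_poly_topology d) (pos_hom_poly d)) (V_proj d \<nu> j)
       \<and> lower_semicontinuous_map
           (subtopology (hom_poly_topology d) (pos_hom_poly d)) (V_restr d \<nu> j)"
proof -
  have d: "d > 0" using assms(2) by simp
  \<comment> \<open>The guard matches the range in which \<open>\<nu> j\<close> is a Haar measure;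
    for \<open>j = CARD('n)\<close> both functionals are given by \<open>V_top\<close>.\<close>
  have \<nu>: "j < CARD('n) \<Longrightarrow> space (\<nu> j) = grassmannian j"
    using assms(4,5) by (intro space_grassmannian_haar) auto
  show ?thesis
    using assms(6) d \<nu>
    by (intro conjI lower_semicontinuous_map_pos_hom_poly[where j = j] V_proj_dilation_le V_restr_dilation_le) auto
qed

end
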